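(* Let $f\in\mathfrak W$, and assume that $f(Z)$ is invertible in $\mathbb{BC}$ for every $Z\in\partial\mathbb K$. Then $f$ is invertible in the bicomplex Wiener algebra $\mathfrak W$, i.e. there is $g\in\mathfrak W$ with $f(Z)g(Z)=1$ for all $Z\in\partial\mathbb K$.
   Context: $\mathbb{BC}$ is the commutative algebra of bicomplex numbers $Z=z_1+jz_2$, $z_1,z_2\in\mathbb C$ (imaginary unit $i$), where $j^2=-1$ and $ij=ji=:k$ (so $k^2=1$). Put $\mathbf e_1=\frac{1+k}{2}$, $\mathbf e_2=\frac{1-k}{2}$; these are idempotents with $\mathbf e_1\mathbf e_2=0$, $\mathbf e_1+\mathbf e_2=1$, and every $Z=z_1+jz_2$ is uniquely $Z=\lambda_1\mathbf e_1+\lambda_2\mathbf e_2$ with $\lambda_1=z_1-iz_2$, $\lambda_2=z_1+iz_2\in\mathbb C$. Addition and multiplication are componentwise in this representation. The norm is $\|Z\|=|\lambda_1|+|\lambda_2|$. The bicomplex unit circle is $\partial\mathbb K=\{e^{it}e^{js}: t,s\in[0,2\pi]\}\subset\mathbb{BC}$, where $e^{js}=\cos s+j\sin s$ (equivalently the set of $Z$ with $|\lambda_1|=|\lambda_2|=1$). The bicomplex Wiener algebra $\mathfrak W$ is the set of functions $f:\partial\mathbb K\to\mathbb{BC}$ of the form $f(Z)=\sum_{n\in\mathbb Z}f_nZ^n$ with $f_n\in\mathbb{BC}$ and $\sum_{n\in\mathbb Z}\|f_n\|<\infty$, with pointwise multiplication. *)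

theory Defs
  imports "HOL-Analysis.Analysis"
begin

text \<open>\<open>BC z\<^sub>1 z\<^sub>2\<close> is the bicomplex number \<open>z\<^sub>1 + j z\<^sub>2\<close>.\<close>

datatype bicomplex = BC (bc_fst: complex) (bc_snd: complex)

lemma bicomplex_eq_iff: "Z = W \<longleftrightarrow> bc_fst Z = bc_fst W \<and> bc_snd Z = bc_snd W"
  by (cases Z; cases W) simp

instantiation bicomplex :: comm_ring_1
begin

definition "0 = BC 0 0"
definition "1 = BC 1 0"
definition "Z + W = BC (bc_fst Z + bc_fst W) (bc_snd Z + bc_snd W)"
definition "- Z = BC (- bc_fst Z) (- bc_snd Z)"
definition "Z - W = BC (bc_fst Z - bc_fst W) (bc_snd Z - bc_snd W)"
definition "Z * W = BC (bc_fst Z * bc_fst W - bc_snd Z * bc_snd W)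
                       (bc_fst Z * bc_snd W + bc_snd Z * bc_fst W)"

instance
  by standard
    (simp_all add: zero_bicomplex_def one_bicomplex_def plus_bicomplex_def uminus_bicomplex_def
      minus_bicomplex_def times_bicomplex_def bicomplex_eq_iff algebra_simps)

end

lemma bicomplex_sel [simp]:
  "bc_fst 0 = 0" "bc_snd 0 = 0" "bc_fst 1 = 1" "bc_snd 1 = 0"
  "bc_fst (Z + W) = bc_fst Z + bc_fst W" "bc_snd (Z + W) = bc_snd Z + bc_snd W"
  "bc_fst (- Z) = - bc_fst Z" "bc_snd (- Z) = - bc_snd Z"
  "bc_fst (Z - W) = bc_fst Z - bc_fst W" "bc_snd (Z - W) = bc_snd Z - bc_snd W"
  "bc_fst (Z * W) = bc_fst Z * bc_fst W - bc_snd Z * bc_snd W"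
  "bc_snd (Z * W) = bc_fst Z * bc_snd W + bc_snd Z * bc_fst W"
  by (simp_all add: zero_bicomplex_def one_bicomplex_def plus_bicomplex_def uminus_bicomplex_def
      minus_bicomplex_def times_bicomplex_def)

definition bc_of_complex :: "complex \<Rightarrow> bicomplex"
  where "bc_of_complex z = BC z 0"

definition bc_i :: bicomplex where "bc_i = bc_of_complex \<i>"
definition bc_j :: bicomplex where "bc_j = BC 0 1"
definition bc_k :: bicomplex where "bc_k = bc_i * bc_j"
definition bc_e1 :: bicomplex where "bc_e1 = bc_of_complex (1/2) * (1 + bc_k)"
definition bc_e2 :: bicomplex where "bc_e2 = bc_of_complex (1/2) * (1 - bc_k)"

definition lambda1 :: "bicomplex \<Rightarrow> complex"
  where "lambda1 Z = bc_fst Z - \<i> * bc_snd Z"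

definition lambda2 :: "bicomplex \<Rightarrow> complex"
  where "lambda2 Z = bc_fst Z + \<i> * bc_snd Z"

lemma bicomplex_expand: "Z = bc_of_complex (bc_fst Z) + bc_j * bc_of_complex (bc_snd Z)"
  by (simp add: bicomplex_eq_iff bc_of_complex_def bc_j_def)

lemma bc_unit_relations:
  "bc_j * bc_j = - 1" "bc_i * bc_i = - 1" "bc_k * bc_k = 1"
  "bc_e1 * bc_e1 = bc_e1" "bc_e2 * bc_e2 = bc_e2" "bc_e1 * bc_e2 = 0" "bc_e1 + bc_e2 = 1"
  by (simp_all add: bicomplex_eq_iff bc_of_complex_def bc_i_def bc_j_def bc_k_def
      bc_e1_def bc_e2_def)

lemma bicomplex_idempotent_expand:
  "Z = bc_of_complex (lambda1 Z) * bc_e1 + bc_of_complex (lambda2 Z) * bc_e2"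
  by (simp add: bicomplex_eq_iff bc_of_complex_def bc_i_def bc_j_def bc_k_def
      bc_e1_def bc_e2_def lambda1_def lambda2_def field_simps)

lemma lambda_eq_iff: "Z = W \<longleftrightarrow> lambda1 Z = lambda1 W \<and> lambda2 Z = lambda2 W"
  by (metis bicomplex_idempotent_expand)

lemma lambda_simps [simp]:
  "lambda1 0 = 0" "lambda2 0 = 0" "lambda1 1 = 1" "lambda2 1 = 1"
  "lambda1 (Z + W) = lambda1 Z + lambda1 W" "lambda2 (Z + W) = lambda2 Z + lambda2 W"
  "lambda1 (- Z) = - lambda1 Z" "lambda2 (- Z) = - lambda2 Z"
  "lambda1 (Z - W) = lambda1 Z - lambda1 W" "lambda2 (Z - W) = lambda2 Z - lambda2 W"
  "lambda1 (Z * W) = lambda1 Z * lambda1 W" "lambda2 (Z * W) = lambda2 Z * lambda2 W"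
  by (simp_all add: lambda1_def lambda2_def algebra_simps)

instantiation bicomplex :: real_algebra_1
begin

definition "scaleR r Z = BC (r *\<^sub>R bc_fst Z) (r *\<^sub>R bc_snd Z)"

instance
  by standard (simp_all add: scaleR_bicomplex_def bicomplex_eq_iff algebra_simps)

end

lemma lambda_scaleR [simp]:
  "lambda1 (r *\<^sub>R Z) = r *\<^sub>R lambda1 Z" "lambda2 (r *\<^sub>R Z) = r *\<^sub>R lambda2 Z"
  by (simp_all add: lambda1_def lambda2_def scaleR_bicomplex_def algebra_simps)

instantiation bicomplex :: real_normed_algebra
begin

definition norm_bicomplex_def: "norm Z = cmod (lambda1 Z) + cmod (lambda2 Z)"
definition sgn_bicomplex_def: "sgn (Z::bicomplex) = Z /\<^sub>R norm Z"
definition dist_bicomplex_def: "dist (Z::bicomplex) W = norm (Z - W)"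
definition uniformity_bicomplex_def:
  "(uniformity :: (bicomplex \<times> bicomplex) filter) =
    (INF e\<in>{0 <..}. principal {(x, y). dist x y < e})"
definition open_bicomplex_def:
  "open (U :: bicomplex set) \<longleftrightarrow>
    (\<forall>x\<in>U. eventually (\<lambda>(x', y). x' = x \<longrightarrow> y \<in> U) uniformity)"

instance
proof
  fix r :: real and x y :: bicomplex
  show "norm x = 0 \<longleftrightarrow> x = 0"
    by (simp add: norm_bicomplex_def lambda_eq_iff add_nonneg_eq_0_iff)
  show "norm (x + y) \<le> norm x + norm y"
    using norm_triangle_ineq[of "lambda1 x" "lambda1 y"] norm_triangle_ineq[of "lambda2 x" "lambda2 y"]
    by (simp add: norm_bicomplex_def)
  show "norm (r *\<^sub>R x) = \<bar>r\<bar> * norm x"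
    by (simp add: norm_bicomplex_def algebra_simps)
  show "norm (x * y) \<le> norm x * norm y"
    by (simp add: norm_bicomplex_def norm_mult algebra_simps)
qed (rule sgn_bicomplex_def dist_bicomplex_def open_bicomplex_def uniformity_bicomplex_def)+

end

text \<open>
  The formula \<open>(z\<^sub>1 + j z\<^sub>2)\<^sup>-\<^sup>1 = (z\<^sub>1 - j z\<^sub>2) / (z\<^sub>1\<^sup>2 + z\<^sub>2\<^sup>2)\<close>; on
  non-invertible elements the denominator vanishes and the value is \<open>0\<close>. It gives meaning
  to the negative powers in \<open>powi\<close>.
\<close>

instantiation bicomplex :: inverse
begin

definition inverse_bicomplex_def:
  "inverse Z = BC (bc_fst Z / ((bc_fst Z)\<^sup>2 + (bc_snd Z)\<^sup>2))
                  (- bc_snd Z / ((bc_fst Z)\<^sup>2 + (bc_snd Z)\<^sup>2))"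
definition divide_bicomplex_def: "(Z::bicomplex) div W = Z * inverse W"

instance ..

end

lemma lambda1_times_lambda2: "lambda1 Z * lambda2 Z = (bc_fst Z)\<^sup>2 + (bc_snd Z)\<^sup>2"
  by (simp add: lambda1_def lambda2_def power2_eq_square algebra_simps)

lemma bicomplex_mult_inverse:
  assumes "lambda1 Z \<noteq> 0" "lambda2 Z \<noteq> 0"
  shows "Z * inverse Z = 1"
proof -
  have "(bc_fst Z)\<^sup>2 + (bc_snd Z)\<^sup>2 \<noteq> 0"
    using assms by (simp flip: lambda1_times_lambda2)
  then show ?thesis
    by (simp add: bicomplex_eq_iff inverse_bicomplex_def power2_eq_square flip: add_divide_distrib)
qed

lemma bicomplex_is_unit_iff: "(Z::bicomplex) dvd 1 \<longleftrightarrow> lambda1 Z \<noteq> 0 \<and> lambda2 Z \<noteq> 0"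
proof
  assume "Z dvd 1"
  then obtain W where "1 = Z * W" by (rule dvdE)
  then have "lambda1 Z * lambda1 W = 1" "lambda2 Z * lambda2 W = 1"
    by (simp_all add: lambda_eq_iff)
  then show "lambda1 Z \<noteq> 0 \<and> lambda2 Z \<noteq> 0" by auto
next
  assume "lambda1 Z \<noteq> 0 \<and> lambda2 Z \<noteq> 0"
  then show "Z dvd 1" using bicomplex_mult_inverse[of Z] by (metis dvd_triv_left)
qed

definition bc_exp_j :: "real \<Rightarrow> bicomplex"
  where "bc_exp_j s = bc_of_complex (cos s) + bc_j * bc_of_complex (sin s)"

definition bc_circle :: "bicomplex set"
  where "bc_circle = {bc_of_complex (exp (\<i> * t)) * bc_exp_j s |t s :: real.
    t \<in> {0..2*pi} \<and> s \<in> {0..2*pi}}"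

lemma lambda_bc_exp_j: "lambda1 (bc_exp_j s) = cis (- s)" "lambda2 (bc_exp_j s) = cis s"
  by (simp_all add: lambda1_def lambda2_def bc_exp_j_def bc_of_complex_def bc_j_def
      complex_eq_iff cos_of_real sin_of_real)

lemma lambda_bc_of_complex: "lambda1 (bc_of_complex z) = z" "lambda2 (bc_of_complex z) = z"
  by (simp_all add: lambda1_def lambda2_def bc_of_complex_def)

lemma bc_circle_iff: "Z \<in> bc_circle \<longleftrightarrow> cmod (lambda1 Z) = 1 \<and> cmod (lambda2 Z) = 1"
proof
  assume "Z \<in> bc_circle"
  then obtain t s :: real where "Z = bc_of_complex (exp (\<i> * t)) * bc_exp_j s"
    by (auto simp: bc_circle_def)
  then show "cmod (lambda1 Z) = 1 \<and> cmod (lambda2 Z) = 1"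
    by (simp add: norm_mult lambda_bc_exp_j lambda_bc_of_complex)
next
  assume "cmod (lambda1 Z) = 1 \<and> cmod (lambda2 Z) = 1"
  then obtain a b where ab: "lambda1 Z = cis a" "lambda2 Z = cis b"
    by (metis complex_norm_eq_1_exp cis_conv_exp)
  have *: "\<exists>t. 0 \<le> t \<and> t \<le> 2 * pi \<and> cis t = cis x" for x
    using sincos_total_2pi[of "cos x" "sin x"]
    by (metis cis.code sin_cos_squared_add2 order_less_imp_le)
  obtain t where t: "0 \<le> t" "t \<le> 2 * pi" "cis t = cis ((a + b) / 2)" using * by blast
  obtain s where s: "0 \<le> s" "s \<le> 2 * pi" "cis s = cis ((b - a) / 2)" using * by blast
  have s': "cis (- s) = cis ((a - b) / 2)"
    using s(3) by (metis cis_cnj minus_diff_eq minus_divide_left)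
  have "lambda1 Z = cis t * cis (- s)" "lambda2 Z = cis t * cis s"
    unfolding t(3) s(3) s' ab cis_mult by (simp_all add: field_simps)
  then have "Z = bc_of_complex (exp (\<i> * t)) * bc_exp_j s"
    unfolding lambda_eq_iff by (simp add: lambda_bc_exp_j lambda_bc_of_complex flip: cis_conv_exp)
  then show "Z \<in> bc_circle"
    using t(1,2) s(1,2) unfolding bc_circle_def mem_Collect_eq atLeastAtMost_iff by blast
qed

lemma bc_circle_unit: "Z \<in> bc_circle \<Longrightarrow> Z dvd 1"
  using bc_circle_iff[of Z] by (auto simp: bicomplex_is_unit_iff)

text \<open>
  Functions on the circle are extensional (\<open>undefined\<close> off the circle), so that elements of
  the algebra are determined by their values on the circle.
\<close>

definition bc_wiener :: "(bicomplex \<Rightarrow> bicomplex) set"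
  where "bc_wiener = {f \<in> bc_circle \<rightarrow>\<^sub>E UNIV.
    \<exists>c :: int \<Rightarrow> bicomplex. (\<lambda>n. norm (c n)) summable_on UNIV \<and>
      (\<forall>Z\<in>bc_circle. ((\<lambda>n. c n * Z powi n) has_sum f Z) UNIV)}"

end

theory Submission
  imports Defs "HOL-Computational_Algebra.Fundamental_Theorem_Algebra"
begin

text \<open>
  In the idempotent components the claim splits into two instances of Wiener's lemma for
  absolutely convergent Laurent series on the complex unit circle. For the latter we follow
  Newman: with \<open>\<delta> = min |f|\<close>, approximate \<open>f\<close> within \<open>\<delta>/4\<close> in the Wiener norm by a Laurent
  polynomial \<open>P\<close>, and expand \<open>1/f = \<Sum>n. (P - f)\<^sup>n / P\<^sup>n\<^sup>+\<^sup>1\<close>. Here \<open>|P| \<ge> \<delta>/2\<close> on some annulus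
  \<open>1/r \<le> |z| \<le> r\<close> with \<open>r > 1\<close>, and there \<open>1/P\<close> is a product of geometric series by the
  fundamental theorem of algebra. Cauchy's estimate on the two boundary circles, obtained by
  averaging over roots of unity, bounds the Wiener norm of \<open>1/P\<^sup>n\<close> by a constant times \<open>(2/\<delta>)\<^sup>n\<close>,
  so the expansion converges in the Wiener norm.
\<close>

section \<open>Laurent series with a weighted norm bound\<close>

definition annulus :: "real \<Rightarrow> complex set"
  where "annulus r = {z. 1 / r \<le> cmod z \<and> cmod z \<le> r}"

text \<open>A bound on a weighted Wiener norm, the ordinary one for \<open>r = 1\<close>. For
  \<open>r \<ge> 1\<close> the weight is the maximum of |z^n| over the annulus, so the first series
  dominates the second there. Bounding some coefficient family, instead of defining a norm, avoids
  uniqueness of coefficients.\<close>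

definition wiener_le :: "real \<Rightarrow> real \<Rightarrow> (complex \<Rightarrow> complex) \<Rightarrow> bool"
  where "wiener_le r M g \<longleftrightarrow> (\<exists>c :: int \<Rightarrow> complex. \<exists>S.
    ((\<lambda>n. cmod (c n) * r ^ nat \<bar>n\<bar>) has_sum S) UNIV \<and> S \<le> M \<and>
    (\<forall>z\<in>annulus r. ((\<lambda>n. c n * z powi n) has_sum g z) UNIV))"

lemma norm_powi_annulus:
  assumes "z \<in> annulus r" "r \<ge> 1"
  shows "cmod (z powi n) \<le> r ^ nat \<bar>n\<bar>"
proof (cases "n \<ge> 0")
  case True
  then show ?thesis
    using assms by (auto simp: power_int_def norm_power annulus_def intro!: power_mono)
next
  case False
  have "inverse (cmod z) \<le> inverse (1 / r)"
    using assms by (intro le_imp_inverse_le) (auto simp: annulus_def)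
  then have "inverse (cmod z) ^ nat (- n) \<le> r ^ nat (- n)"
    by (intro power_mono) auto
  then show ?thesis
    using False by (simp add: power_int_def norm_power norm_inverse abs_if)
qed

lemma annulus_nonzero: "z \<in> annulus r \<Longrightarrow> r \<ge> 1 \<Longrightarrow> z \<noteq> 0"
  by (auto simp: annulus_def)

lemma annulus_1: "annulus 1 = sphere 0 1"
  by (auto simp: annulus_def)

text \<open>
  The exponents \<open>p i\<close> may repeat: coefficients belonging to the same power are collected.
  Rearrangements such as Cauchy products and sums of series are instances of this.
\<close>

lemma wiener_leI:
  fixes a :: "'i \<Rightarrow> complex" and p :: "'i \<Rightarrow> int"
  assumes r: "r \<ge> 1"
    and S: "((\<lambda>i. cmod (a i) * r ^ nat \<bar>p i\<bar>) has_sum S) I" "S \<le> M"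
    and g: "\<And>z. z \<in> annulus r \<Longrightarrow> ((\<lambda>i. a i * z powi p i) has_sum g z) I"
  shows "wiener_le r M g"
proof -
  define J where "J n = {i \<in> I. p i = n}" for n
  define w where "w = (\<lambda>i. cmod (a i) * r ^ nat \<bar>p i\<bar>)"
  define c where "c n = infsum a (J n)" for n
  define W where "W n = infsum w (J n)" for n
  \<comment> \<open>\<open>I\<close> is the disjoint union of the fibres of \<open>p\<close>, so a
    sum over \<open>I\<close> can be taken first within fibres and then over exponents.\<close>
  have bij: "bij_betw (\<lambda>i. (p i, i)) I (Sigma UNIV J)"
    by (rule bij_betwI[where g = snd]) (auto simp: J_def)
  have w: "(w has_sum S) I"
    using S(1) by (simp add: w_def)
  have wJ: "(w has_sum W n) (J n)" for n
    unfolding W_def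
    by (intro has_sum_infsum summable_on_subset_banach[OF has_sum_imp_summable[OF w]])
      (auto simp: J_def)
  have "((\<lambda>x. w (snd x)) has_sum S) (Sigma UNIV J)"
    using w has_sum_reindex_bij_betw[OF bij, of "\<lambda>x. w (snd x)" S] by simp
  then have WS: "(W has_sum S) UNIV"
    by (rule has_sum_SigmaD) (use wJ in simp)
  \<comment> \<open>The weight is at least 1, so \<open>a\<close> is summable on every fibre and
    \<open>c n\<close> is a genuine sum, not the default value 0 of \<open>infsum\<close>.\<close>
  have a_le: "cmod (a i) \<le> w i" for i
    using r by (simp add: w_def mult_le_cancel_left1)
  have "(\<lambda>i. norm (a i)) summable_on I"
    by (rule Infinite_Sum.abs_summable_on_comparison_test'[OF has_sum_imp_summable[OF w]]) (rule a_le)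
  then have "a summable_on J n" for n
    by (rule summable_on_subset_banach[OF abs_summable_summable]) (auto simp: J_def)
  then have aJ: "(a has_sum c n) (J n)" for n
    by (simp add: c_def)
  \<comment> \<open>Triangle inequality within one fibre, on which the weight is constant.\<close>
  have c_le: "cmod (c n) * r ^ nat \<bar>n\<bar> \<le> W n" for n
  proof -
    have "cmod (c n * of_real (r ^ nat \<bar>n\<bar>)) \<le> W n"
      by (rule norm_infsum_le[OF has_sum_cmult_left[OF aJ] wJ])
        (use r in \<open>simp add: J_def w_def norm_mult norm_power\<close>)
    then show ?thesis
      using r by (simp add: norm_mult norm_power)
  qed
  have csum: "(\<lambda>n. cmod (c n) * r ^ nat \<bar>n\<bar>) summable_on UNIV"
    by (rule summable_on_comparison_test[OF has_sum_imp_summable[OF WS]])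
      (use c_le r in auto)
  have "infsum (\<lambda>n. cmod (c n) * r ^ nat \<bar>n\<bar>) UNIV \<le> S"
    by (rule has_sum_mono[OF has_sum_infsum[OF csum] WS]) (rule c_le)
  moreover have "((\<lambda>n. c n * z powi n) has_sum g z) UNIV" if z: "z \<in> annulus r" for z
  proof -
    have sum: "((\<lambda>x. a (snd x) * z powi p (snd x)) has_sum g z) (Sigma UNIV J)"
      using g[OF z] has_sum_reindex_bij_betw[OF bij, of "\<lambda>x. a (snd x) * z powi p (snd x)" "g z"]
      by simp
    have fibre: "((\<lambda>i. a i * z powi p i) has_sum c n * z powi n) (J n)" for n
      using has_sum_cmult_left[OF aJ[of n], of "z powi n"]
      by (rule has_sum_cong[THEN iffD1, rotated]) (simp add: J_def)
    show ?thesis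
      by (rule has_sum_SigmaD[OF sum]) (simp add: fibre)
  qed
  ultimately show ?thesis
    unfolding wiener_le_def using has_sum_infsum[OF csum] S(2) by (meson order_trans)
qed

text \<open>The double series over pairs (i, n) converges absolutely because its inner weighted sums
  are at most \<open>M i\<close>; \<open>wiener_leI\<close> with exponent \<open>snd\<close> then
  collects equal powers.\<close>

lemma wiener_le_has_sum:
  fixes g :: "'i \<Rightarrow> complex \<Rightarrow> complex"
  assumes r: "r \<ge> 1"
    and g: "\<And>i. i \<in> I \<Longrightarrow> wiener_le r (M i) (g i)"
    and M: "(M has_sum T) I"
    and h: "\<And>z. z \<in> annulus r \<Longrightarrow> ((\<lambda>i. g i z) has_sum h z) I"
  shows "wiener_le r T h"
proof -
  define Q where "Q i c S \<longleftrightarrow> ((\<lambda>n. cmod (c n) * r ^ nat \<bar>n\<bar>) has_sum S) UNIV \<and> S \<le> M i \<and>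
    (\<forall>z\<in>annulus r. ((\<lambda>n. c n * z powi n) has_sum g i z) UNIV)" for i c S
  have "\<forall>i\<in>I. \<exists>c S. Q i c S"
    using g by (simp add: wiener_le_def Q_def)
  then obtain c S where "\<And>i. i \<in> I \<Longrightarrow> Q i (c i) (S i)"
    by metis
  then have cS: "\<And>i. i \<in> I \<Longrightarrow> ((\<lambda>n. cmod (c i n) * r ^ nat \<bar>n\<bar>) has_sum S i) UNIV"
      "\<And>i. i \<in> I \<Longrightarrow> S i \<le> M i"
      "\<And>i z. i \<in> I \<Longrightarrow> z \<in> annulus r \<Longrightarrow> ((\<lambda>n. c i n * z powi n) has_sum g i z) UNIV"
    by (auto simp: Q_def)
  have S0: "0 \<le> S i" if "i \<in> I" for i
    by (rule has_sum_nonneg[OF cS(1)[OF that]]) (use r in auto)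
  have Ssum: "S summable_on I"
    by (rule summable_on_comparison_test[OF has_sum_imp_summable[OF M]]) (use cS(2) S0 in auto)
  let ?w = "\<lambda>x. cmod (c (fst x) (snd x)) * r ^ nat \<bar>snd x\<bar>"
  have wsum: "?w summable_on Sigma I (\<lambda>_. UNIV)"
    by (rule summable_on_SigmaI[OF _ Ssum]) (use cS(1) r in auto)
  have "(?w has_sum infsum S I) (Sigma I (\<lambda>_. UNIV))"
    by (rule has_sum_SigmaI[OF _ has_sum_infsum[OF Ssum] wsum]) (use cS(1) in simp)
  moreover have "infsum S I \<le> T"
    by (rule has_sum_mono[OF has_sum_infsum[OF Ssum] M]) (rule cS(2))
  moreover have "((\<lambda>x. c (fst x) (snd x) * z powi snd x) has_sum h z) (Sigma I (\<lambda>_. UNIV))"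
    if z: "z \<in> annulus r" for z
  proof (rule has_sum_SigmaI[OF _ h[OF z]])
    show "(\<lambda>x. c (fst x) (snd x) * z powi snd x) summable_on Sigma I (\<lambda>_. UNIV)"
      by (rule abs_summable_summable[OF Infinite_Sum.abs_summable_on_comparison_test'[OF wsum]])
        (use norm_powi_annulus[OF z r] in \<open>auto simp: norm_mult intro!: mult_left_mono\<close>)
  qed (use cS(3) z in simp)
  ultimately show ?thesis
    by (rule wiener_leI[OF r])
qed

lemma wiener_le_cong:
  assumes "wiener_le r M g" "\<And>z. z \<in> annulus r \<Longrightarrow> g z = h z"
  shows "wiener_le r M h"
  using assms(1) unfolding wiener_le_def by (simp add: assms(2))

text \<open>Exponents shift by \<open>m\<close>, and |m + n| \<le> |m| + |n| makes the weight
  submultiplicative.\<close>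

lemma wiener_le_mult_monom:
  assumes r: "r \<ge> 1" and g: "wiener_le r M g"
  shows "wiener_le r (cmod a * r ^ nat \<bar>m\<bar> * M) (\<lambda>z. a * z powi m * g z)"
proof -
  obtain c S where cS: "((\<lambda>n. cmod (c n) * r ^ nat \<bar>n\<bar>) has_sum S) UNIV" "S \<le> M"
      "\<And>z. z \<in> annulus r \<Longrightarrow> ((\<lambda>n. c n * z powi n) has_sum g z) UNIV"
    using g unfolding wiener_le_def by metis
  let ?v = "\<lambda>n. cmod (a * c n) * r ^ nat \<bar>m + n\<bar>"
  have w: "((\<lambda>n. cmod a * r ^ nat \<bar>m\<bar> * (cmod (c n) * r ^ nat \<bar>n\<bar>)) has_sum cmod a * r ^ nat \<bar>m\<bar> * S) UNIV"
    by (rule has_sum_cmult_right[OF cS(1)])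
  have le: "?v n \<le> cmod a * r ^ nat \<bar>m\<bar> * (cmod (c n) * r ^ nat \<bar>n\<bar>)" for n
  proof -
    have "r ^ nat \<bar>m + n\<bar> \<le> r ^ (nat \<bar>m\<bar> + nat \<bar>n\<bar>)"
      by (rule power_increasing) (use r in auto)
    then have "cmod (a * c n) * r ^ nat \<bar>m + n\<bar> \<le> cmod (a * c n) * r ^ (nat \<bar>m\<bar> + nat \<bar>n\<bar>)"
      by (rule mult_left_mono) simp
    then show ?thesis
      by (simp add: norm_mult power_add mult_ac)
  qed
  have vsum: "?v summable_on UNIV"
    by (rule summable_on_comparison_test[OF has_sum_imp_summable[OF w]]) (use le r in auto)
  have "infsum ?v UNIV \<le> cmod a * r ^ nat \<bar>m\<bar> * S"
    by (rule has_sum_mono[OF has_sum_infsum[OF vsum] w]) (rule le)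
  also have "\<dots> \<le> cmod a * r ^ nat \<bar>m\<bar> * M"
    using cS(2) r by (intro mult_left_mono) auto
  finally have "infsum ?v UNIV \<le> cmod a * r ^ nat \<bar>m\<bar> * M" .
  moreover have "((\<lambda>n. a * c n * z powi (m + n)) has_sum a * z powi m * g z) UNIV"
    if z: "z \<in> annulus r" for z
    using has_sum_cmult_right[OF cS(3)[OF z], of "a * z powi m"] annulus_nonzero[OF z r]
    by (simp add: power_int_add mult_ac)
  ultimately show ?thesis
    by (rule wiener_leI[OF r has_sum_infsum[OF vsum]])
qed

text \<open>Only \<open>g\<close> is expanded: the product is then a series of monomial multiples of
  \<open>h\<close>.\<close>

lemma wiener_le_mult:
  assumes r: "r \<ge> 1" and g: "wiener_le r M g" and h: "wiener_le r N h"
  shows "wiener_le r (M * N) (\<lambda>z. g z * h z)"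
proof -
  obtain c S where cS: "((\<lambda>n. cmod (c n) * r ^ nat \<bar>n\<bar>) has_sum S) UNIV" "S \<le> M"
      "\<And>z. z \<in> annulus r \<Longrightarrow> ((\<lambda>n. c n * z powi n) has_sum g z) UNIV"
    using g unfolding wiener_le_def by metis
  \<comment> \<open>\<open>N\<close> bounds a sum of nonnegative terms. This allows enlarging
    \<open>S * N\<close> to \<open>M * N\<close> at the end.\<close>
  have "0 \<le> N"
    using h r unfolding wiener_le_def
    by (metis (no_types, lifting) has_sum_nonneg mult_nonneg_nonneg norm_ge_zero order_trans
        zero_le_power zero_le_one)
  have "wiener_le r (S * N) (\<lambda>z. g z * h z)"
  proof (rule wiener_le_has_sum[where I = UNIV, OF r])
    show "wiener_le r (cmod (c n) * r ^ nat \<bar>n\<bar> * N) (\<lambda>z. c n * z powi n * h z)" for n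
      by (rule wiener_le_mult_monom[OF r h])
    show "((\<lambda>n. cmod (c n) * r ^ nat \<bar>n\<bar> * N) has_sum S * N) UNIV"
      by (rule has_sum_cmult_left[OF cS(1)])
    show "((\<lambda>n. c n * z powi n * h z) has_sum g z * h z) UNIV" if "z \<in> annulus r" for z
      by (rule has_sum_cmult_left[OF cS(3)[OF that]])
  qed
  then show ?thesis
    using mult_right_mono[OF cS(2) \<open>0 \<le> N\<close>] unfolding wiener_le_def by (meson order_trans)
qed

lemma wiener_le_monom:
  assumes "r \<ge> 1"
  shows "wiener_le r (cmod a * r ^ nat \<bar>m\<bar>) (\<lambda>z. a * z powi m)"
  by (rule wiener_leI[OF assms, where I = "{()}" and a = "\<lambda>_. a" and p = "\<lambda>_. m"])
    (auto intro!: has_sum_finiteI)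

lemma wiener_le_power:
  assumes r: "r \<ge> 1" and g: "wiener_le r M g"
  shows "wiener_le r (M ^ n) (\<lambda>z. g z ^ n)"
proof (induction n)
  case 0
  show ?case
    using wiener_le_monom[OF r, of 1 0] by simp
next
  case (Suc n)
  show ?case
    using wiener_le_mult[OF r g Suc] by simp
qed

lemma has_sum_geometric:
  fixes x :: "'a :: {real_normed_field, banach}"
  assumes "norm x < 1"
  shows "((\<lambda>n. x ^ n) has_sum 1 / (1 - x)) UNIV"
  by (rule norm_summable_imp_has_sum)
    (use assms in \<open>auto simp: norm_power intro!: geometric_sums\<close>)

section \<open>Inverses of Laurent polynomials\<close>

text \<open>Geometric series in z/a if \<open>a\<close> lies beyond the outer circle, in a/z if it
  lies within the inner one. In the weighted norm the ratio is r/|a| or |a| r, both below 1.\<close>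

lemma wiener_le_inverse_linear:
  assumes r: "r \<ge> 1" and a: "a \<notin> annulus r"
  shows "\<exists>M. wiener_le r M (\<lambda>z. 1 / (z - a))"
proof (cases "cmod a > r")
  case True
  have a0: "a \<noteq> 0" using True r by auto
  have "wiener_le r (cmod (- 1 / a) * (1 / (1 - r / cmod a))) (\<lambda>z. 1 / (z - a))"
  proof (rule wiener_le_has_sum[OF r, where I = UNIV])
    show "wiener_le r (cmod (- 1 / a) * (r / cmod a) ^ n) (\<lambda>z. - 1 / a * (z / a) ^ n)" for n
      using wiener_le_monom[OF r, of "- 1 / a * (1 / a) ^ n" "int n"]
      by (simp add: norm_mult norm_power norm_divide power_divide mult_ac)
    show "((\<lambda>n. cmod (- 1 / a) * (r / cmod a) ^ n) has_sum cmod (- 1 / a) * (1 / (1 - r / cmod a))) UNIV"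
      by (intro has_sum_cmult_right has_sum_geometric) (use True r a0 in \<open>simp add: divide_less_eq\<close>)
    show "((\<lambda>n. - 1 / a * (z / a) ^ n) has_sum 1 / (z - a)) UNIV" if z: "z \<in> annulus r" for z
    proof -
      have "cmod (z / a) < 1"
        using True z a0 by (simp add: norm_divide annulus_def)
      then have "((\<lambda>n. - 1 / a * (z / a) ^ n) has_sum - 1 / a * (1 / (1 - z / a))) UNIV"
        by (intro has_sum_cmult_right has_sum_geometric)
      moreover have "z \<noteq> a" using True z by (auto simp: annulus_def)
      then have "- 1 / a * (1 / (1 - z / a)) = 1 / (z - a)"
        using a0 by (simp add: field_simps)
      ultimately show ?thesis by simp
    qed
  qed
  then show ?thesis ..
next
  case False
  \<comment> \<open>This case includes \<open>a = 0\<close>, where only the term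
    \<open>n = 0\<close> of the series survives.\<close>
  then have ar: "cmod a < 1 / r"
    using a by (auto simp: annulus_def)
  have "wiener_le r (r * (1 / (1 - cmod a * r))) (\<lambda>z. 1 / (z - a))"
  proof (rule wiener_le_has_sum[OF r, where I = UNIV])
    show "wiener_le r (r * (cmod a * r) ^ n) (\<lambda>z. a ^ n * z powi (- int (Suc n)))" for n
      using wiener_le_monom[OF r, of "a ^ n" "- int (Suc n)"]
      by (simp add: norm_power power_mult_distrib mult_ac nat_add_distrib)
    show "((\<lambda>n. r * (cmod a * r) ^ n) has_sum r * (1 / (1 - cmod a * r))) UNIV"
      by (intro has_sum_cmult_right has_sum_geometric)
        (use ar r in \<open>simp add: abs_mult field_simps\<close>)
    show "((\<lambda>n. a ^ n * z powi (- int (Suc n))) has_sum 1 / (z - a)) UNIV"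
      if z: "z \<in> annulus r" for z
    proof -
      have z0: "z \<noteq> 0" using annulus_nonzero[OF z r] .
      have az: "cmod a < cmod z"
        using ar z by (auto simp: annulus_def)
      then have "cmod (a / z) < 1"
        using z0 by (simp add: norm_divide)
      then have "((\<lambda>n. 1 / z * (a / z) ^ n) has_sum 1 / z * (1 / (1 - a / z))) UNIV"
        by (intro has_sum_cmult_right has_sum_geometric)
      moreover have "z \<noteq> a" using az by auto
      then have "1 / z * (1 / (1 - a / z)) = 1 / (z - a)"
        using z0 by (simp add: field_simps)
      moreover have "1 / z * (a / z) ^ n = a ^ n * z powi (- int (Suc n))" for n
        unfolding power_int_minus power_int_of_nat by (simp add: field_simps)
      ultimately show ?thesis by simp
    qed
  qed
  then show ?thesis ..
qed

text \<open>Induction on the degree, splitting off one root at a time; every root lies outside the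
  annulus. Any finite \<open>M\<close> will do, since the quantitative bound comes later from
  Cauchy's estimate.\<close>

lemma wiener_le_inverse_poly:
  fixes q :: "complex poly"
  assumes r: "r \<ge> 1" and q: "\<And>z. z \<in> annulus r \<Longrightarrow> poly q z \<noteq> 0"
  shows "\<exists>M. wiener_le r M (\<lambda>z. 1 / poly q z)"
  using q
proof (induction "degree q" arbitrary: q)
  case 0
  then obtain b where b: "q = [:b:]"
    by (metis degree_eq_zeroE)
  show ?case
    using wiener_le_monom[OF r, of "1 / b" 0] by (auto simp: b)
next
  case (Suc n)
  have "\<not> constant (poly q)"
    using Suc.hyps(2) by (simp add: constant_degree)
  then obtain a where a: "poly q a = 0"
    using fundamental_theorem_of_algebra by blast
  then obtain s where s: "q = [:- a, 1:] * s"
    by (auto simp: poly_eq_0_iff_dvd elim: dvdE)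
  have "s \<noteq> 0" using s Suc.hyps(2) by auto
  then have "degree s = n"
    using Suc.hyps(2) by (simp add: s degree_mult_eq del: mult_pCons_left)
  moreover have "poly s z \<noteq> 0" if "z \<in> annulus r" for z
    using Suc.prems[OF that] by (simp add: s del: mult_pCons_left)
  ultimately obtain M where M: "wiener_le r M (\<lambda>z. 1 / poly s z)"
    using Suc.hyps(1) by blast
  have "a \<notin> annulus r" using Suc.prems a by blast
  then obtain N where N: "wiener_le r N (\<lambda>z. 1 / (z - a))"
    using wiener_le_inverse_linear[OF r] by blast
  have "1 / (z - a) * (1 / poly s z) = 1 / poly q z" for z
    by (simp add: s del: mult_pCons_left)
  then show ?case
    using wiener_le_mult[OF r N M] by auto
qed

text \<open>A factor z^N clears the negative exponents and leaves a polynomial with the same zeros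
  off the origin, apart from the origin itself.\<close>

lemma wiener_le_inverse_laurent_poly:
  fixes c :: "int \<Rightarrow> complex"
  assumes r: "r \<ge> 1" and F: "finite F"
    and nz: "\<And>z. z \<in> annulus r \<Longrightarrow> (\<Sum>n\<in>F. c n * z powi n) \<noteq> 0"
  shows "\<exists>M. wiener_le r M (\<lambda>z. 1 / (\<Sum>n\<in>F. c n * z powi n))"
proof -
  obtain N where N: "\<And>n. n \<in> F \<Longrightarrow> \<bar>n\<bar> \<le> int N"
  proof
    fix n assume "n \<in> F"
    then have "nat \<bar>n\<bar> \<le> (\<Sum>n\<in>F. nat \<bar>n\<bar>)"
      by (rule member_le_sum) (use F in auto)
    then show "\<bar>n\<bar> \<le> int (\<Sum>n\<in>F. nat \<bar>n\<bar>)" by linarith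
  qed
  define q where "q = (\<Sum>n\<in>F. monom (c n) (nat (n + int N)))"
  have q: "poly q z = z powi int N * (\<Sum>n\<in>F. c n * z powi n)" if "z \<noteq> 0" for z
  proof -
    have "z ^ nat (n + int N) = z powi int N * z powi n" if "n \<in> F" for n
    proof -
      have "z ^ nat (n + int N) = z powi (n + int N)"
        using N[OF that] by (simp add: power_int_def)
      then show ?thesis
        using \<open>z \<noteq> 0\<close> by (simp add: power_int_add)
    qed
    then show ?thesis
      by (simp add: q_def poly_sum poly_monom sum_distrib_left mult_ac)
  qed
  have "poly q z \<noteq> 0" if "z \<in> annulus r" for z
    using q[OF annulus_nonzero[OF that r]] nz[OF that] annulus_nonzero[OF that r] by simp
  then obtain M where M: "wiener_le r M (\<lambda>z. 1 / poly q z)"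
    using wiener_le_inverse_poly[OF r] by blast
  \<comment> \<open>The factor is restored: the inverse sought is z^N times 1 / q(z).\<close>
  have "wiener_le r (cmod 1 * r ^ nat \<bar>int N\<bar> * M) (\<lambda>z. 1 / (\<Sum>n\<in>F. c n * z powi n))"
    by (rule wiener_le_cong[OF wiener_le_mult_monom[OF r M, of 1 "int N"]])
      (use q annulus_nonzero[OF _ r] in simp)
  then show ?thesis ..
qed

section \<open>Coefficient estimates\<close>

text \<open>Orthogonality of characters: for \<open>l \<noteq> 0\<close> this is a full geometric
  sum whose ratio is an N-th root of unity, and |l| < N keeps that ratio different from 1.\<close>

lemma sum_root_unity_powi:
  assumes "\<bar>l\<bar> < int N"
  shows "(\<Sum>j<N. cis (2 * pi * real j / real N) powi l) = (if l = 0 then of_nat N else 0)"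
proof (cases "l = 0")
  case False
  define x where "x = cis (2 * pi * real_of_int l / real N)"
  have N: "N > 0" using assms by auto
  have "x \<noteq> 1"
  proof
    assume "x = 1"
    then have "cos (2 * pi * real_of_int l / real N) = 1"
      by (simp add: x_def complex_eq_iff)
    then obtain k :: int where "2 * pi * real_of_int l / real N = of_int k * 2 * pi"
      by (auto simp: cos_one_2pi_int)
    then have "real_of_int l = real_of_int (k * int N)"
      using N by (simp add: field_simps)
    then have "l = k * int N" by (simp only: of_int_eq_iff)
    then have "int N dvd l" by simp
    then show False
      using assms False zdvd_imp_le[of "int N" "\<bar>l\<bar>"] by auto
  qed
  have "cis (2 * pi * real j / real N) powi l = x ^ j" for j
    by (simp add: cis_power_int x_def Complex.DeMoivre mult_ac)
  then have "(\<Sum>j<N. cis (2 * pi * real j / real N) powi l) = (\<Sum>j<N. x ^ j)"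
    by simp
  also have "\<dots> = (x ^ N - 1) / (x - 1)"
    using \<open>x \<noteq> 1\<close> by (rule geometric_sum)
  also have "x ^ N = cis (2 * pi * real_of_int l)"
    using N by (simp add: x_def Complex.DeMoivre)
  also have "\<dots> = 1" by (simp add: cis_multiple_2pi)
  finally show ?thesis using False by simp
qed simp

text \<open>Cauchy's estimate with the contour integral replaced by an average over N equally spaced
  points. This is exact for a finite Laurent sum once N exceeds every |n - k|.\<close>

lemma laurent_poly_coeff_le:
  fixes c :: "int \<Rightarrow> complex"
  assumes F: "finite F" "k \<in> F" and \<rho>: "\<rho> > 0"
    and B: "\<And>z. cmod z = \<rho> \<Longrightarrow> cmod (\<Sum>n\<in>F. c n * z powi n) \<le> B"
  shows "cmod (c k) * \<rho> powi k \<le> B"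
proof -
  \<comment> \<open>The witness is the sum of all |n - k|, plus 1 for strictness.\<close>
  obtain N where N: "N > 0" "\<And>n. n \<in> F \<Longrightarrow> \<bar>n - k\<bar> < int N"
  proof
    fix n assume "n \<in> F"
    then have "nat \<bar>n - k\<bar> \<le> (\<Sum>n\<in>F. nat \<bar>n - k\<bar>)"
      by (rule member_le_sum) (use F in auto)
    then show "\<bar>n - k\<bar> < int (Suc (\<Sum>n\<in>F. nat \<bar>n - k\<bar>))" by linarith
  qed simp
  let ?w = "\<lambda>j. cis (2 * pi * real j / real N)"
  let ?z = "\<lambda>j. complex_of_real \<rho> * ?w j"
  \<comment> \<open>Twisting by the power \<open>- k\<close> moves the k-th coefficient to exponent
    0, the only one that survives the summation.\<close>
  have "(\<Sum>j<N. ?w j powi (- k) * (\<Sum>n\<in>F. c n * ?z j powi n))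
      = (\<Sum>j<N. \<Sum>n\<in>F. c n * of_real \<rho> powi n * ?w j powi (n - k))"
    by (simp add: sum_distrib_left power_int_mult_distrib power_int_diff power_int_minus
        divide_inverse mult_ac)
  also have "\<dots> = (\<Sum>n\<in>F. c n * of_real \<rho> powi n * (\<Sum>j<N. ?w j powi (n - k)))"
    by (subst sum.swap) (simp add: sum_distrib_left)
  also have "\<dots> = (\<Sum>n\<in>F. if n = k then c n * of_real \<rho> powi n * of_nat N else 0)"
    by (intro sum.cong refl) (simp add: sum_root_unity_powi N(2))
  also have "\<dots> = c k * of_real \<rho> powi k * of_nat N"
    using F by simp
  finally have eq: "c k * of_real \<rho> powi k * of_nat N
      = (\<Sum>j<N. ?w j powi (- k) * (\<Sum>n\<in>F. c n * ?z j powi n))" ..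
  have "cmod (c k) * \<rho> powi k * real N = cmod (c k * of_real \<rho> powi k * of_nat N)"
    using \<rho> by (simp add: norm_mult norm_power_int)
  also have "\<dots> \<le> (\<Sum>j<N. B)"
    unfolding eq
  proof (rule sum_norm_le)
    fix j
    show "cmod (?w j powi (- k) * (\<Sum>n\<in>F. c n * ?z j powi n)) \<le> B"
      using B[of "?z j"] \<rho> by (simp add: norm_mult norm_power_int)
  qed
  finally show ?thesis using N(1) by simp
qed

lemma norm_laurent_tail_le:
  fixes c :: "int \<Rightarrow> complex"
  assumes r: "r \<ge> 1" and z: "z \<in> annulus r"
    and S: "((\<lambda>n. cmod (c n) * r ^ nat \<bar>n\<bar>) has_sum S) UNIV"
    and g: "((\<lambda>n. c n * z powi n) has_sum y) UNIV" and F: "finite F"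
  shows "cmod (y - (\<Sum>n\<in>F. c n * z powi n)) \<le> S - (\<Sum>n\<in>F. cmod (c n) * r ^ nat \<bar>n\<bar>)"
proof (rule norm_infsum_le)
  show "((\<lambda>n. c n * z powi n) has_sum y - (\<Sum>n\<in>F. c n * z powi n)) (UNIV - F)"
    by (rule has_sum_Diff[OF g has_sum_finite[OF F]]) simp
  show "((\<lambda>n. cmod (c n) * r ^ nat \<bar>n\<bar>) has_sum S - (\<Sum>n\<in>F. cmod (c n) * r ^ nat \<bar>n\<bar>)) (UNIV - F)"
    by (rule has_sum_Diff[OF S has_sum_finite[OF F]]) simp
  show "cmod (c n * z powi n) \<le> cmod (c n) * r ^ nat \<bar>n\<bar>" for n
    using norm_powi_annulus[OF z r] by (simp add: norm_mult mult_left_mono)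
qed

lemma summable_on_inverse_power_abs:
  assumes "(r::real) > 1"
  shows "(\<lambda>n::int. (1 / r) ^ nat \<bar>n\<bar>) summable_on UNIV"
proof -
  let ?f = "\<lambda>n::int. (1 / r) ^ nat \<bar>n\<bar>"
  have geo: "(\<lambda>n. (1 / r) ^ n) summable_on (UNIV :: nat set)"
    by (rule has_sum_imp_summable[OF has_sum_geometric]) (use assms in simp)
  have "?f summable_on range int"
    by (subst summable_on_reindex) (use geo in \<open>simp_all add: o_def\<close>)
  moreover have "?f summable_on range (\<lambda>n. - int n)"
    by (subst summable_on_reindex) (use geo in \<open>simp_all add: o_def inj_on_def\<close>)
  moreover have "range int \<union> range (\<lambda>n. - int n) = UNIV"
    by (auto intro: int_cases2)
  ultimately show ?thesis
    by (metis summable_on_union)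
qed

text \<open>Cauchy's estimate gives |c k| \<le> B r^(-|k|), which is summable. The resulting bound
  depends on \<open>g\<close> only through \<open>B\<close>, so for powers of a function it grows
  like powers of the supremum.\<close>

lemma wiener_le_1_if_bounded:
  assumes r: "r > 1" and g: "wiener_le r M g"
    and B: "\<And>z. z \<in> annulus r \<Longrightarrow> cmod (g z) \<le> B"
  shows "wiener_le 1 (B * (\<Sum>\<^sub>\<infinity>n::int. (1 / r) ^ nat \<bar>n\<bar>)) g"
proof -
  have r1: "r \<ge> 1" using r by simp
  obtain c S where cS: "((\<lambda>n. cmod (c n) * r ^ nat \<bar>n\<bar>) has_sum S) UNIV"
      "\<And>z. z \<in> annulus r \<Longrightarrow> ((\<lambda>n. c n * z powi n) has_sum g z) UNIV"
    using g unfolding wiener_le_def by metis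
  have c_le: "cmod (c k) \<le> B * (1 / r) ^ nat \<bar>k\<bar>" for k
  proof -
    \<comment> \<open>The boundary circle is chosen by the sign of \<open>k\<close>, so that its
      radius to the power \<open>k\<close> equals r^|k|.\<close>
    define \<rho> where "\<rho> = (if k \<ge> 0 then r else 1 / r)"
    have \<rho>: "\<rho> > 0" using r by (simp add: \<rho>_def)
    have \<rho>_powi: "\<rho> powi k = r ^ nat \<bar>k\<bar>"
      by (simp add: \<rho>_def power_int_def power_divide inverse_eq_divide)
    \<comment> \<open>Cauchy's estimate is available for finite sums, so the series is truncated to
      a set containing \<open>k\<close> whose complement has weight below \<open>e\<close>.\<close>
    have "cmod (c k) * \<rho> powi k \<le> B + e" if e: "e > 0" for e
    proof -
      have "\<forall>\<^sub>F X in finite_subsets_at_top UNIV. dist (\<Sum>n\<in>X. cmod (c n) * r ^ nat \<bar>n\<bar>) S < e"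
        using cS(1) e unfolding has_sum_def by (rule tendstoD)
      then obtain X where X: "finite X"
          "\<And>Y. finite Y \<Longrightarrow> X \<subseteq> Y \<Longrightarrow> dist (\<Sum>n\<in>Y. cmod (c n) * r ^ nat \<bar>n\<bar>) S < e"
        unfolding eventually_finite_subsets_at_top by auto
      let ?F = "insert k X"
      have tail: "S - (\<Sum>n\<in>?F. cmod (c n) * r ^ nat \<bar>n\<bar>) < e"
        using X(2)[of ?F] X(1) unfolding dist_real_def by (smt (verit) finite_insert subset_insertI)
      show ?thesis
      proof (rule laurent_poly_coeff_le[where F = ?F])
        fix z assume "cmod z = \<rho>"
        then have z: "z \<in> annulus r"
          using r mult_mono[of 1 r 1 r] by (auto simp: \<rho>_def annulus_def field_simps split: if_splits)
        have "cmod (\<Sum>n\<in>?F. c n * z powi n)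
            \<le> cmod (g z) + cmod (g z - (\<Sum>n\<in>?F. c n * z powi n))"
          by (metis norm_minus_commute norm_triangle_sub)
        also have "\<dots> \<le> B + e"
          using B[OF z] tail norm_laurent_tail_le[OF r1 z cS(1) cS(2)[OF z], of ?F] X(1) by simp
        finally show "cmod (\<Sum>n\<in>?F. c n * z powi n) \<le> B + e" .
      qed (use X(1) \<rho> in auto)
    qed
    then have "cmod (c k) * \<rho> powi k \<le> B"
      by (rule field_le_epsilon)
    then show ?thesis
      using r by (simp add: \<rho>_powi power_divide field_simps)
  qed
  let ?q = "\<lambda>n::int. (1 / r) ^ nat \<bar>n\<bar>"
  have q: "((\<lambda>n. B * ?q n) has_sum B * infsum ?q UNIV) UNIV"
    by (intro has_sum_cmult_right has_sum_infsum summable_on_inverse_power_abs r)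
  have csum: "(\<lambda>n. cmod (c n)) summable_on UNIV"
    by (rule summable_on_comparison_test[OF has_sum_imp_summable[OF q]]) (use c_le in auto)
  have "infsum (\<lambda>n. cmod (c n)) UNIV \<le> B * infsum ?q UNIV"
    by (rule has_sum_mono[OF has_sum_infsum[OF csum] q]) (rule c_le)
  moreover have "annulus 1 \<subseteq> annulus r"
    using r by (auto simp: annulus_def)
  ultimately show ?thesis
    unfolding wiener_le_def using has_sum_infsum[OF csum] cS(2) by auto
qed

section \<open>Wiener's lemma\<close>

theorem wiener_lemma:
  fixes c :: "int \<Rightarrow> complex" and f :: "complex \<Rightarrow> complex"
  assumes c: "(\<lambda>n. cmod (c n)) summable_on UNIV"
    and f: "\<And>z. cmod z = 1 \<Longrightarrow> ((\<lambda>n. c n * z powi n) has_sum f z) UNIV"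
    and nz: "\<And>z. cmod z = 1 \<Longrightarrow> f z \<noteq> 0"
  obtains d where "(\<lambda>n. cmod (d n)) summable_on UNIV"
    "\<And>z. cmod z = 1 \<Longrightarrow> ((\<lambda>n. d n * z powi n) has_sum 1 / f z) UNIV"
proof -
  have cont_powi: "continuous_on A (\<lambda>z. \<Sum>n\<in>X. c n * z powi n)" if "0 \<notin> A" for A X
    by (intro continuous_intros) (use that in auto)
  \<comment> \<open>Uniform convergence makes \<open>f\<close> continuous on the compact circle, so
    |f| attains a minimum, which is positive by \<open>nz\<close>.\<close>
  have "uniform_limit (sphere 0 1) (\<lambda>X z. \<Sum>n\<in>X. c n * z powi n) f (finite_subsets_at_top UNIV)"
    by (rule Weierstrass_m_test_general'[OF _ _ c]) (use f in \<open>auto simp: norm_mult norm_power_int\<close>)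
  then have "continuous_on (sphere 0 1) f"
    by (rule uniform_limit_theorem[rotated]) (auto intro!: always_eventually cont_powi)
  then have "\<exists>x\<in>sphere 0 1. \<forall>y\<in>sphere 0 1. cmod (f x) \<le> cmod (f y)"
    by (intro continuous_attains_inf continuous_on_norm) auto
  then obtain x where x: "cmod x = 1" "\<And>y. cmod y = 1 \<Longrightarrow> cmod (f x) \<le> cmod (f y)"
    by auto
  define \<delta> where "\<delta> = cmod (f x)"
  have \<delta>: "\<delta> > 0" "\<And>y. cmod y = 1 \<Longrightarrow> \<delta> \<le> cmod (f y)"
    using x nz by (auto simp: \<delta>_def)
  define S where "S = (\<Sum>\<^sub>\<infinity>n. cmod (c n))"
  have S: "((\<lambda>n. cmod (c n)) has_sum S) UNIV"
    using c by (simp add: S_def)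
  \<comment> \<open>A quarter of \<delta> leaves |P| \<ge> 3\<delta>/4 on the circle; another
    quarter is lost in passing to the annulus, and (\<delta>/4)(2/\<delta>) = 1/2 < 1.\<close>
  obtain F where F: "finite F" "dist (\<Sum>n\<in>F. cmod (c n)) S \<le> \<delta> / 4"
    using has_sum_finite_approximation[OF S, of "\<delta> / 4"] \<delta>(1) by auto
  define P where "P z = (\<Sum>n\<in>F. c n * z powi n)" for z
  have tail: "S - (\<Sum>n\<in>F. cmod (c n)) \<le> \<delta> / 4"
    using F(2) unfolding dist_real_def by linarith
  have fP: "wiener_le 1 (\<delta> / 4) (\<lambda>z. P z - f z)"
  proof (rule wiener_leI[where I = "UNIV - F" and a = "\<lambda>n. - c n" and p = "\<lambda>n. n"])
    show "((\<lambda>n. cmod (- c n) * 1 ^ nat \<bar>n\<bar>) has_sum S - (\<Sum>n\<in>F. cmod (c n))) (UNIV - F)"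
      using has_sum_Diff[OF S has_sum_finite[OF F(1)]] by simp
    show "((\<lambda>n. - c n * z powi n) has_sum P z - f z) (UNIV - F)" if "z \<in> annulus 1" for z
    proof -
      have "((\<lambda>n. c n * z powi n) has_sum f z - P z) (UNIV - F)"
        unfolding P_def
        by (rule has_sum_Diff[OF f has_sum_finite[OF F(1)]]) (use that in \<open>auto simp: annulus_1\<close>)
      then show ?thesis
        by (auto dest: has_sum_uminusI simp: algebra_simps)
    qed
  qed (use tail in auto)
  have fP_norm: "cmod (P z - f z) \<le> \<delta> / 4" if "cmod z = 1" for z
    using norm_laurent_tail_le[of 1 z c S "f z" F] S f[OF that] F(1) that tail
    by (simp add: annulus_1 P_def norm_minus_commute)
  have P_circle: "cmod (P z) \<ge> 3 / 4 * \<delta>" if "cmod z = 1" for z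
    using fP_norm[OF that] \<delta>(2)[OF that] norm_triangle_ineq2[of "f z" "P z"]
    by (simp add: norm_minus_commute)
  \<comment> \<open>A compact shell that avoids 0, where negative powers are continuous, and
    contains every annulus with 1 \<le> r \<le> 2.\<close>
  have "compact (cball 0 2 - ball 0 (1/2) :: complex set)"
    by (intro compact_diff) auto
  then have "uniformly_continuous_on (cball 0 2 - ball 0 (1/2)) P"
    unfolding P_def by (intro compact_uniformly_continuous cont_powi) auto
  then obtain \<eta> where \<eta>: "\<eta> > 0" "\<And>z w. z \<in> cball 0 2 - ball 0 (1/2) \<Longrightarrow>
      w \<in> cball 0 2 - ball 0 (1/2) \<Longrightarrow> dist z w < \<eta> \<Longrightarrow> dist (P z) (P w) < \<delta> / 4"
    using \<delta>(1) unfolding uniformly_continuous_on_def by (metis zero_less_divide_iff zero_less_numeral)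
  \<comment> \<open>The first bound keeps the annulus in the shell; the second keeps its points
    closer than \<eta> to the unit circle.\<close>
  define r where "r = 1 + min 1 (\<eta> / 2)"
  have r: "r > 1" "r \<le> 2" "r - 1 < \<eta>"
    using \<eta>(1) by (auto simp: r_def)
  then have r1: "r \<ge> 1" by simp
  have P_annulus: "cmod (P z) \<ge> \<delta> / 2" if z: "z \<in> annulus r" for z
  proof -
    have z0: "z \<noteq> 0" using annulus_nonzero[OF z r1] .
    have "1 / 2 \<le> 1 / r" using r by (simp add: field_simps)
    then have zr: "1 / 2 \<le> cmod z" "cmod z \<le> r"
      using z by (auto simp: annulus_def)
    \<comment> \<open>Equivalent to (r - 1)^2 \<ge> 0; it shows that the inner circle is no farther
      from the unit circle than the outer one.\<close>
    have "2 - r \<le> 1 / r"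
      using r zero_le_square[of "r - 1"] by (simp add: field_simps power2_eq_square)
    then have abs: "\<bar>cmod z - 1\<bar> < \<eta>"
      using z r by (auto simp: annulus_def)
    \<comment> \<open>The radial projection of \<open>z\<close> to the unit circle, where |P| is
      already bounded below.\<close>
    define w where "w = z / of_real (cmod z)"
    have w: "cmod w = 1" using z0 by (simp add: w_def norm_divide)
    have "z - w = w * of_real (cmod z - 1)"
      using z0 by (simp add: w_def field_simps)
    then have "cmod (z - w) = \<bar>cmod z - 1\<bar>"
      by (simp only: norm_mult w norm_of_real mult_1)
    then have "cmod (P z - P w) < \<delta> / 4"
      using \<eta>(2)[of z w] zr r w abs by (simp add: dist_norm)
    then show ?thesis
      using P_circle[OF w] norm_triangle_ineq2[of "P w" "P z"] by (simp add: norm_minus_commute)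
  qed
  then have "P z \<noteq> 0" if "z \<in> annulus r" for z
    using that \<delta>(1) by fastforce
  then obtain M where M: "wiener_le r M (\<lambda>z. 1 / P z)"
    using wiener_le_inverse_laurent_poly[OF r1 F(1), of c] unfolding P_def by blast
  define C where "C = (\<Sum>\<^sub>\<infinity>n::int. (1 / r) ^ nat \<bar>n\<bar>)"
  have inv_P: "wiener_le 1 ((2 / \<delta>) ^ n * C) (\<lambda>z. (1 / P z) ^ n)" for n
    unfolding C_def
  proof (rule wiener_le_1_if_bounded[OF r(1) wiener_le_power[OF r1 M]])
    fix z assume z: "z \<in> annulus r"
    have "cmod (1 / P z) \<le> 2 / \<delta>"
      using P_annulus[OF z] \<delta>(1) le_imp_inverse_le[of "\<delta> / 2" "cmod (P z)"]
      by (simp add: norm_divide inverse_eq_divide)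
    then show "cmod ((1 / P z) ^ n) \<le> (2 / \<delta>) ^ n"
      unfolding norm_power by (rule power_mono) simp
  qed
  have "wiener_le 1 (2 / \<delta> * C * (1 / (1 - 1 / 2))) (\<lambda>z. 1 / f z)"
  proof (rule wiener_le_has_sum[where I = UNIV])
    fix n
    \<comment> \<open>The extra factor 2/\<delta> comes from the exponent \<open>Suc n\<close> of
      1/P.\<close>
    have eq: "(\<delta> / 4) ^ n * ((2 / \<delta>) ^ Suc n * C) = 2 / \<delta> * C * (1 / 2) ^ n"
    proof -
      have "(\<delta> / 4) ^ n * (2 / \<delta>) ^ n = (1 / 2) ^ n"
        unfolding power_mult_distrib[symmetric] using \<delta>(1) by simp
      then show ?thesis by (simp add: mult_ac)
    qed
    show "wiener_le 1 (2 / \<delta> * C * (1 / 2) ^ n) (\<lambda>z. (P z - f z) ^ n * (1 / P z) ^ Suc n)"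
      using wiener_le_mult[OF _ wiener_le_power[OF _ fP] inv_P, of n "Suc n"]
      unfolding eq by simp
  next
    show "((\<lambda>n. 2 / \<delta> * C * (1 / 2) ^ n) has_sum 2 / \<delta> * C * (1 / (1 - 1 / 2))) UNIV"
      by (intro has_sum_cmult_right has_sum_geometric) simp
  next
    fix z :: complex assume "z \<in> annulus 1"
    then have z: "cmod z = 1" by (simp add: annulus_1)
    have Pz: "P z \<noteq> 0" using P_circle[OF z] \<delta>(1) by fastforce
    have "cmod (P z - f z) < cmod (P z)"
      using fP_norm[OF z] P_circle[OF z] \<delta>(1) by linarith
    then have "cmod ((P z - f z) / P z) < 1"
      using Pz by (simp add: norm_divide)
    then have "((\<lambda>n. 1 / P z * ((P z - f z) / P z) ^ n)
        has_sum 1 / P z * (1 / (1 - (P z - f z) / P z))) UNIV"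
      by (intro has_sum_cmult_right has_sum_geometric)
    moreover have "1 / P z * (1 / (1 - (P z - f z) / P z)) = 1 / f z"
      using Pz nz[OF z] by (simp add: field_simps)
    moreover have "1 / P z * ((P z - f z) / P z) ^ n = (P z - f z) ^ n * (1 / P z) ^ Suc n" for n
      by (simp add: power_divide)
    ultimately show "((\<lambda>n. (P z - f z) ^ n * (1 / P z) ^ Suc n) has_sum 1 / f z) UNIV"
      by (simp only:)
  qed simp
  then obtain d T where d: "((\<lambda>n. cmod (d n)) has_sum T) UNIV"
      "\<And>z. z \<in> annulus 1 \<Longrightarrow> ((\<lambda>n. d n * z powi n) has_sum 1 / f z) UNIV"
    unfolding wiener_le_def by auto
  show thesis
    by (rule that[OF has_sum_imp_summable[OF d(1)] d(2)]) (simp add: annulus_1)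
qed

section \<open>Bicomplex numbers\<close>

lemma lambda_power: "lambda1 (Z ^ n) = lambda1 Z ^ n" "lambda2 (Z ^ n) = lambda2 Z ^ n"
  by (induction n) simp_all

text \<open>On a nonunit \<open>inverse\<close> is 0, although one component may be nonzero; hence
  the restriction to units.\<close>

lemma lambda_inverse:
  assumes "Z dvd 1"
  shows "lambda1 (inverse Z) = inverse (lambda1 Z)" "lambda2 (inverse Z) = inverse (lambda2 Z)"
proof -
  have "Z * inverse Z = 1"
    using assms by (simp add: bicomplex_is_unit_iff bicomplex_mult_inverse)
  then have "lambda1 Z * lambda1 (inverse Z) = 1" "lambda2 Z * lambda2 (inverse Z) = 1"
    by (simp_all add: lambda_eq_iff)
  then show "lambda1 (inverse Z) = inverse (lambda1 Z)" "lambda2 (inverse Z) = inverse (lambda2 Z)"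
    by (simp_all add: inverse_unique)
qed

lemma lambda_powi:
  assumes "Z dvd 1"
  shows "lambda1 (Z powi n) = lambda1 Z powi n" "lambda2 (Z powi n) = lambda2 Z powi n"
  by (simp_all add: power_int_def lambda_power lambda_inverse[OF assms])

lemma bounded_linear_lambda: "bounded_linear lambda1" "bounded_linear lambda2"
  by (auto intro!: bounded_linear_intro[where K = 1] simp: norm_bicomplex_def)

definition bc_of_lambdas :: "complex \<Rightarrow> complex \<Rightarrow> bicomplex"
  where "bc_of_lambdas x y = bc_of_complex x * bc_e1 + bc_of_complex y * bc_e2"

lemma lambda_bc_of_lambdas [simp]:
  "lambda1 (bc_of_lambdas x y) = x" "lambda2 (bc_of_lambdas x y) = y"
  by (simp_all add: bc_of_lambdas_def lambda1_def lambda2_def bc_of_complex_def bc_i_def bc_j_def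
      bc_k_def bc_e1_def bc_e2_def algebra_simps)

lemma bounded_linear_bc_of_lambdas:
  "bounded_linear (\<lambda>x. bc_of_lambdas x 0)" "bounded_linear (bc_of_lambdas 0)"
  by (auto intro!: bounded_linear_intro[where K = 1] simp: norm_bicomplex_def lambda_eq_iff)

text \<open>The two projections and the embeddings of the two idempotent components are bounded
  linear, hence commute with infinite sums.\<close>

lemma has_sum_bicomplex_iff:
  "(h has_sum S) A \<longleftrightarrow>
    ((\<lambda>n. lambda1 (h n)) has_sum lambda1 S) A \<and> ((\<lambda>n. lambda2 (h n)) has_sum lambda2 S) A"
  (is "?l \<longleftrightarrow> ?r")
proof
  assume ?l
  then show ?r
    by (auto intro: has_sum_bounded_linear[OF bounded_linear_lambda(1), unfolded o_def]
        has_sum_bounded_linear[OF bounded_linear_lambda(2), unfolded o_def])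
next
  assume r: ?r
  have Z: "bc_of_lambdas (lambda1 Z) 0 + bc_of_lambdas 0 (lambda2 Z) = Z" for Z
    by (simp add: lambda_eq_iff)
  show ?l
    using has_sum_add[OF has_sum_bounded_linear[OF bounded_linear_bc_of_lambdas(1) conjunct1[OF r]]
        has_sum_bounded_linear[OF bounded_linear_bc_of_lambdas(2) conjunct2[OF r]]]
    by (simp add: Z)
qed

theorem theorem1p18:
  fixes f :: "bicomplex \<Rightarrow> bicomplex"
  assumes "f \<in> bc_wiener"
    and "\<forall>Z\<in>bc_circle. f Z dvd 1"
  shows "\<exists>g\<in>bc_wiener. \<forall>Z\<in>bc_circle. f Z * g Z = 1"
proof -
  obtain c where c: "(\<lambda>n. norm (c n)) summable_on UNIV"
      "\<And>Z. Z \<in> bc_circle \<Longrightarrow> ((\<lambda>n. c n * Z powi n) has_sum f Z) UNIV"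
    using assms(1) by (auto simp: bc_wiener_def)
  \<comment> \<open>On these points both idempotent components equal \<open>z\<close>, so each
    component of \<open>f\<close> becomes a function on the complex unit circle.\<close>
  have circ: "bc_of_complex z \<in> bc_circle" if "cmod z = 1" for z
    using that by (simp add: bc_circle_iff lambda_bc_of_complex)
  have fs: "((\<lambda>n. lambda1 (c n) * lambda1 Z powi n) has_sum lambda1 (f Z)) UNIV"
      "((\<lambda>n. lambda2 (c n) * lambda2 Z powi n) has_sum lambda2 (f Z)) UNIV"
    if "Z \<in> bc_circle" for Z
    using c(2)[OF that] bc_circle_unit[OF that]
    by (simp_all add: has_sum_bicomplex_iff lambda_powi)
  \<comment> \<open>Each component of f(Z) depends only on the same component of \<open>Z\<close>,
    because both sides are sums of the same series.\<close>
  have f_eq: "lambda1 (f Z) = lambda1 (f (bc_of_complex (lambda1 Z)))"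
      "lambda2 (f Z) = lambda2 (f (bc_of_complex (lambda2 Z)))" if "Z \<in> bc_circle" for Z
  proof -
    have n: "cmod (lambda1 Z) = 1" "cmod (lambda2 Z) = 1"
      using that by (auto simp: bc_circle_iff)
    show "lambda1 (f Z) = lambda1 (f (bc_of_complex (lambda1 Z)))"
      using fs(1)[OF that] fs(1)[OF circ[OF n(1)]]
      by (simp add: lambda_bc_of_complex has_sum_unique)
    show "lambda2 (f Z) = lambda2 (f (bc_of_complex (lambda2 Z)))"
      using fs(2)[OF that] fs(2)[OF circ[OF n(2)]]
      by (simp add: lambda_bc_of_complex has_sum_unique)
  qed
  have f_unit: "lambda1 (f Z) \<noteq> 0" "lambda2 (f Z) \<noteq> 0" if "Z \<in> bc_circle" for Z
    using assms(2) that by (auto simp: bicomplex_is_unit_iff)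
  obtain d1 where d1: "(\<lambda>n. cmod (d1 n)) summable_on UNIV"
    "\<And>z. cmod z = 1 \<Longrightarrow> ((\<lambda>n. d1 n * z powi n) has_sum 1 / lambda1 (f (bc_of_complex z))) UNIV"
  proof (rule wiener_lemma)
    show "(\<lambda>n. cmod (lambda1 (c n))) summable_on UNIV"
      by (rule summable_on_comparison_test[OF c(1)]) (auto simp: norm_bicomplex_def)
    show "((\<lambda>n. lambda1 (c n) * z powi n) has_sum lambda1 (f (bc_of_complex z))) UNIV"
      if "cmod z = 1" for z
      using fs(1)[OF circ[OF that]] by (simp add: lambda_bc_of_complex)
  qed (use f_unit circ in auto)
  obtain d2 where d2: "(\<lambda>n. cmod (d2 n)) summable_on UNIV"
    "\<And>z. cmod z = 1 \<Longrightarrow> ((\<lambda>n. d2 n * z powi n) has_sum 1 / lambda2 (f (bc_of_complex z))) UNIV"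
  proof (rule wiener_lemma)
    show "(\<lambda>n. cmod (lambda2 (c n))) summable_on UNIV"
      by (rule summable_on_comparison_test[OF c(1)]) (auto simp: norm_bicomplex_def)
    show "((\<lambda>n. lambda2 (c n) * z powi n) has_sum lambda2 (f (bc_of_complex z))) UNIV"
      if "cmod z = 1" for z
      using fs(2)[OF circ[OF that]] by (simp add: lambda_bc_of_complex)
  qed (use f_unit circ in auto)
  define d where "d n = bc_of_lambdas (d1 n) (d2 n)" for n
  \<comment> \<open>Restriction makes \<open>g\<close> extensional, as membership in
    \<open>bc_wiener\<close> demands.\<close>
  define g where "g = restrict (\<lambda>Z. inverse (f Z)) bc_circle"
  have "(\<lambda>n. norm (d n)) summable_on UNIV"
    using summable_on_add[OF d1(1) d2(1)] by (simp add: d_def norm_bicomplex_def)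
  moreover have "((\<lambda>n. d n * Z powi n) has_sum g Z) UNIV" if Z: "Z \<in> bc_circle" for Z
  proof -
    have "cmod (lambda1 Z) = 1" "cmod (lambda2 Z) = 1"
      using Z by (auto simp: bc_circle_iff)
    \<comment> \<open>\<open>f_eq\<close> carries the component expansions from the embedded complex
      points to an arbitrary \<open>Z\<close> of the circle.\<close>
    then show ?thesis
      using d1(2) d2(2) f_eq[OF Z] Z assms(2)
      by (simp add: has_sum_bicomplex_iff d_def g_def lambda_powi bc_circle_unit lambda_inverse
          inverse_eq_divide)
  qed
  moreover have "g \<in> bc_circle \<rightarrow>\<^sub>E UNIV"
    by (simp add: g_def)
  ultimately have "g \<in> bc_wiener"
    unfolding bc_wiener_def by blast
  moreover have "f Z * g Z = 1" if "Z \<in> bc_circle" for Z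
    using that f_unit by (simp add: g_def bicomplex_mult_inverse)
  ultimately show ?thesis by blast
qed

end
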